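(* Let a localizing space decomposition of a real Hilbert space $V$ of functions on $\Omega$ be given, with local spaces $V_1,\dots,V_N$, and suppose that $\{1,\dots,N\}$ can be partitioned into $\bar J$ classes such that $V_i\perp V_j$ whenever $i\neq j$ belong to the same class. Let $a$ be a symmetric, coercive, continuous bilinear form on $V$ with coercivity constant $\alpha$ and continuity constant $\gamma$, $f\in V'$, and let $u\in V$, $u\ne0$, solve $a(u,v)=f(v)$ for all $v\in V$. Let a localized training configuration for this decomposition and this $u$ be given, with training domains $\omega_i^*$, spaces $V|_{\omega_i^*}$, Hilbert spaces $S_i$, bounded linear operators $\mathcal{P}_{S_i}:V|_{\omega_i^*}\to S_i$ and affine linear compact operators $T_i:S_i\to V_i$, and let $J^*$ be the maximum number of training domains overlapping at a point. Write $T_i\varphi=T_i^l\varphi+T_i^a$ with $T_i^l$ linear and $T_i^a\in V_i$. Let $\widetilde V_i\subseteq V_i$ be reduced subspaces with $T_i^a\in\widetilde V_i$ for all $i$, let $\widetilde V:=\sum_{i=1}^N\widetilde V_i$, and let $\widetilde u\in\widetilde V$ solve $a(\widetilde u,v)=f(v)$ for all $v\in\widetilde V$. Then $$\frac{\|u-\widetilde u\|}{\|u\|}\le\sqrt{\frac{\gamma}{\alpha}}\,\sqrt{\bar J\,J^*}\,\max_{i\in\{1,\dots,N\}}\big\|(1-P_{\widetilde V_i})T_i^l\big\|\,\|\mathcal{P}_{S_i}\| ,$$ where $P_{\widetilde V_i}$ is the orthogonal projection onto $\widetilde V_i$ and the norms on the right are operator norms.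
   Context: A localizing space decomposition consists of: an open, bounded, connected domain $\Omega\subset\mathbb{R}^d$ with smooth boundary; a Hilbert space $V$ of functions on $\Omega$; subdomains $\omega_1,\dots,\omega_N$ forming an overlapping or non-overlapping domain decomposition of $\Omega$; subspaces $V_1,\dots,V_N\subseteq V$ with $\sum_i V_i=V$ and $\operatorname{supp}\varphi\subseteq\omega_i$ for all $\varphi\in V_i$; and linear maps $\mathcal{P}_{V_i}:V\to V_i$ with $\sum_i\mathcal{P}_{V_i}(\varphi)=\varphi$ for all $\varphi\in V$. A localized training configuration (for the solution $u$) consists of: training domains $\omega_1^*,\dots,\omega_N^*\subset\Omega$, with $J^*:=\max_{x\in\Omega}\#\{i\mid x\in\omega_i^*\}$; Hilbert spaces $V|_{\omega_i^*}$ (of restrictions to $\omega_i^*$) with norms satisfying $\sum_{i=1}^N\|u|_{\omega_i^*}\|^2\le J^*\|u\|^2$; Hilbert spaces $S_1,\dots,S_N$; bounded linear operators $\mathcal{P}_{S_i}:V|_{\omega_i^*}\to S_i$; and affine linear, compact operators $T_i:S_i\to V_i$, such that $$u=\sum_{i=1}^N T_i\,\mathcal{P}_{S_i}\,u|_{\omega_i^*} .$$ Constants: $\alpha:=\inf_{\varphi\ne0}|a(\varphi,\varphi)|/\|\varphi\|^2>0$, $\gamma:=\sup_{\varphi_1,\varphi_2\neq0}|a(\varphi_1,\varphi_2)|/(\|\varphi_1\|\|\varphi_2\|)$. Subspaces onto which one projects, and $\widetilde V$, are understood to be closed. *)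

theory Defs
  imports "HOL-Analysis.Analysis" "HOL-Library.Set_Algebras" "HOL-Library.Disjoint_Sets"
begin

section \<open>Functions up to equality almost everywhere\<close>

text \<open>
  As usual for Sobolev-type spaces, functions are identified when they agree Lebesgue-almost
  everywhere. A function on a subset of the Euclidean space is represented by its
  extension by zero. Taking \<open>'b = real\<close> gives scalar functions; other choices of \<open>'b\<close> cover
  vector fields.
\<close>

quotient_type (overloaded) ('a, 'b) ae_fun =
  "'a::euclidean_space \<Rightarrow> 'b::real_vector" / "\<lambda>f g. AE x in lebesgue. f x = g x"
proof (rule equivpI)
  show "reflp (\<lambda>f g :: 'a \<Rightarrow> 'b. AE x in lebesgue. f x = g x)"
    by (rule reflpI) simp
  show "symp (\<lambda>f g :: 'a \<Rightarrow> 'b. AE x in lebesgue. f x = g x)"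
    by (rule sympI) (simp add: eq_commute)
  show "transp (\<lambda>f g :: 'a \<Rightarrow> 'b. AE x in lebesgue. f x = g x)"
    by (rule transpI) (rule AE_mp, assumption, rule AE_mp, assumption, simp)
qed

instantiation ae_fun :: (euclidean_space, real_vector) real_vector
begin

lift_definition zero_ae_fun :: "('a, 'b) ae_fun" is "\<lambda>_. 0" .

lift_definition plus_ae_fun :: "('a, 'b) ae_fun \<Rightarrow> ('a, 'b) ae_fun \<Rightarrow> ('a, 'b) ae_fun"
  is "\<lambda>f g x. f x + g x"
  by (rule AE_mp, assumption, rule AE_mp, assumption, simp)

lift_definition uminus_ae_fun :: "('a, 'b) ae_fun \<Rightarrow> ('a, 'b) ae_fun"
  is "\<lambda>f x. - f x"
  by simp

lift_definition minus_ae_fun :: "('a, 'b) ae_fun \<Rightarrow> ('a, 'b) ae_fun \<Rightarrow> ('a, 'b) ae_fun"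
  is "\<lambda>f g x. f x - g x"
  by (rule AE_mp, assumption, rule AE_mp, assumption, simp)

lift_definition scaleR_ae_fun :: "real \<Rightarrow> ('a, 'b) ae_fun \<Rightarrow> ('a, 'b) ae_fun"
  is "\<lambda>c f x. c *\<^sub>R f x"
  by (rule AE_mp, assumption, simp)

instance
  by (intro_classes; transfer) (simp_all add: algebra_simps)

end

text \<open>Restriction to \<open>A\<close>, represented by its extension by zero.\<close>

lift_definition restr :: "'a::euclidean_space set \<Rightarrow> ('a, 'b::real_vector) ae_fun \<Rightarrow> ('a, 'b) ae_fun"
  is "\<lambda>A f x. if x \<in> A then f x else 0"
  by (rule AE_mp, assumption, simp)

definition supp :: "('a::euclidean_space, 'b::real_vector) ae_fun \<Rightarrow> 'a set" where
  "supp \<phi> = - \<Union>{U. open U \<and> restr U \<phi> = 0}"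


section \<open>Domains with smooth boundary\<close>

fun Ck_on :: "nat \<Rightarrow> 'a::euclidean_space set \<Rightarrow> ('a \<Rightarrow> real) \<Rightarrow> bool" where
  "Ck_on 0 U g \<longleftrightarrow> continuous_on U g"
| "Ck_on (Suc k) U g \<longleftrightarrow>
     g differentiable_on U \<and> (\<forall>v. Ck_on k U (\<lambda>x. frechet_derivative g (at x) v))"

text \<open>
  Near each boundary point, \<open>\<Omega>\<close> is the negativity set of a \<open>C\<^sup>\<infinity>\<close> function without critical
  points; in particular it lies locally on one side of its boundary.
\<close>

definition smooth_boundary :: "'a::euclidean_space set \<Rightarrow> bool" where
  "smooth_boundary \<Omega> \<longleftrightarrow>
     (\<forall>p\<in>frontier \<Omega>. \<exists>U g. open U \<and> p \<in> U \<and> (\<forall>k. Ck_on k U g)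
        \<and> (\<forall>x\<in>U. \<exists>v. frechet_derivative g (at x) v \<noteq> 0)
        \<and> \<Omega> \<inter> U = {x\<in>U. g x < 0} \<and> frontier \<Omega> \<inter> U = {x\<in>U. g x = 0})"


section \<open>Hilbert spaces on subsets of a vector space\<close>

text \<open>
  The spaces in a family may be pairwise unrelated: each carries its own inner product on its own
  linear subspace of an ambient vector space without topology. Any finite family
  of Hilbert spaces can be placed in one ambient space, e.g. their direct sum.
  Inner products are unconstrained outside the carrier.
\<close>

record 'v ip_space =
  pts :: "'v set"
  ip :: "'v \<Rightarrow> 'v \<Rightarrow> real"

definition hnorm :: "'v ip_space \<Rightarrow> 'v \<Rightarrow> real" where
  "hnorm X x = sqrt (ip X x x)"

text \<open>Set to zero outside the carrier because \<^locale>\<open>Metric_space\<close> demands nonnegativity and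
  symmetry on the whole type.\<close>

definition hdist :: "'v::real_vector ip_space \<Rightarrow> 'v \<Rightarrow> 'v \<Rightarrow> real" where
  "hdist X x y = (if x \<in> pts X \<and> y \<in> pts X then hnorm X (x - y) else 0)"

abbreviation htopology :: "'v::real_vector ip_space \<Rightarrow> 'v topology" where
  "htopology X \<equiv> Metric_space.mtopology (pts X) (hdist X)"

definition inner_product_space :: "'v::real_vector ip_space \<Rightarrow> bool" where
  "inner_product_space X \<longleftrightarrow>
     subspace (pts X)
   \<and> (\<forall>x\<in>pts X. \<forall>y\<in>pts X. ip X x y = ip X y x)
   \<and> (\<forall>x\<in>pts X. \<forall>y\<in>pts X. \<forall>z\<in>pts X. ip X (x + y) z = ip X x z + ip X y z)
   \<and> (\<forall>x\<in>pts X. \<forall>y\<in>pts X. \<forall>c. ip X (c *\<^sub>R x) y = c * ip X x y)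
   \<and> (\<forall>x\<in>pts X. x \<noteq> 0 \<longrightarrow> 0 < ip X x x)"

definition hilbert_space :: "'v::real_vector ip_space \<Rightarrow> bool" where
  "hilbert_space X \<longleftrightarrow> inner_product_space X \<and> Metric_space.mcomplete (pts X) (hdist X)"

lemma inner_product_space_Cauchy_Schwarz:
  assumes X: "inner_product_space X" and x: "x \<in> pts X" and y: "y \<in> pts X"
  shows "ip X x y \<le> hnorm X x * hnorm X y"
proof -
  have sub: "subspace (pts X)"
    and sym: "\<And>x y. x \<in> pts X \<Longrightarrow> y \<in> pts X \<Longrightarrow> ip X x y = ip X y x"
    and add: "\<And>x y z. x \<in> pts X \<Longrightarrow> y \<in> pts X \<Longrightarrow> z \<in> pts X \<Longrightarrow> ip X (x + y) z = ip X x z + ip X y z"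
    and scale: "\<And>x y c. x \<in> pts X \<Longrightarrow> y \<in> pts X \<Longrightarrow> ip X (c *\<^sub>R x) y = c * ip X x y"
    and pos: "\<And>x. x \<in> pts X \<Longrightarrow> x \<noteq> 0 \<Longrightarrow> 0 < ip X x x"
    using X by (simp_all add: inner_product_space_def)
  have nonneg: "0 \<le> ip X z z" if "z \<in> pts X" for z
    using pos[OF that] scale[OF that that, of 0] by (cases "z = 0") simp_all
  show ?thesis
  proof (cases "y = 0")
    case True
    then show ?thesis
      using scale[OF y x, of 0] scale[OF y y, of 0] sym[OF x y] by (simp add: hnorm_def)
  next
    case False
    define t where "t = - (ip X x y / ip X y y)"
    have ty: "t *\<^sub>R y \<in> pts X" and xty: "x + t *\<^sub>R y \<in> pts X"
      using sub x y by (auto intro: subspace_add subspace_scale)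
    have yy: "0 < ip X y y" using pos y False by blast
    have e1: "ip X x (x + t *\<^sub>R y) = ip X x x + t * ip X x y"
      by (simp only: sym[OF x xty] add[OF x ty x] scale[OF y x] sym[OF y x])
    have e2: "ip X (t *\<^sub>R y) (x + t *\<^sub>R y) = t * (ip X x y + t * ip X y y)"
      by (simp only: scale[OF y xty] sym[OF y xty] add[OF x ty y] scale[OF y y])
    have "0 \<le> ip X (x + t *\<^sub>R y) (x + t *\<^sub>R y)" by (rule nonneg[OF xty])
    also have "\<dots> = (ip X x x + t * ip X x y) + t * (ip X x y + t * ip X y y)"
      by (simp only: add[OF x ty xty] e1 e2)
    also have "\<dots> = ip X x x - (ip X x y)\<^sup>2 / ip X y y"
      using yy by (simp add: t_def power2_eq_square)
    finally have "(ip X x y)\<^sup>2 \<le> ip X x x * ip X y y"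
      using yy by (simp add: field_simps)
    then have "\<bar>ip X x y\<bar> \<le> sqrt (ip X x x * ip X y y)"
      by (simp add: real_le_rsqrt)
    then show ?thesis by (simp add: hnorm_def real_sqrt_mult)
  qed
qed

lemma inner_product_space_Metric_space:
  assumes X: "inner_product_space X"
  shows "Metric_space (pts X) (hdist X)"
proof -
  have sub: "subspace (pts X)"
    and sym: "\<And>x y. x \<in> pts X \<Longrightarrow> y \<in> pts X \<Longrightarrow> ip X x y = ip X y x"
    and add: "\<And>x y z. x \<in> pts X \<Longrightarrow> y \<in> pts X \<Longrightarrow> z \<in> pts X \<Longrightarrow> ip X (x + y) z = ip X x z + ip X y z"
    and scale: "\<And>x y c. x \<in> pts X \<Longrightarrow> y \<in> pts X \<Longrightarrow> ip X (c *\<^sub>R x) y = c * ip X x y"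
    and pos: "\<And>x. x \<in> pts X \<Longrightarrow> x \<noteq> 0 \<Longrightarrow> 0 < ip X x x"
    using X by (simp_all add: inner_product_space_def)
  have ip0: "ip X 0 0 = 0"
    using scale[of 0 0 0] subspace_0[OF sub] by simp
  have nonneg: "0 \<le> ip X z z" if "z \<in> pts X" for z
    using pos[OF that] ip0 by (cases "z = 0") simp_all
  have diff: "x - y \<in> pts X" if "x \<in> pts X" "y \<in> pts X" for x y
    using sub that by (rule subspace_diff)
  have tri: "hnorm X (x + y) \<le> hnorm X x + hnorm X y" if x: "x \<in> pts X" and y: "y \<in> pts X" for x y
  proof -
    have xy: "x + y \<in> pts X" using sub x y by (rule subspace_add)
    have "ip X (x + y) (x + y) = ip X x x + 2 * ip X x y + ip X y y"
      by (simp only: add[OF x y xy] sym[OF x xy] sym[OF y xy] add[OF x y x] add[OF x y y]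
          sym[OF y x])
    also have "\<dots> \<le> (hnorm X x + hnorm X y)\<^sup>2"
      using inner_product_space_Cauchy_Schwarz[OF X x y] nonneg[OF x] nonneg[OF y]
      by (simp add: hnorm_def power2_sum)
    finally show ?thesis
      using nonneg[OF x] nonneg[OF y] by (simp add: hnorm_def real_le_lsqrt)
  qed
  show ?thesis
  proof
    show "0 \<le> hdist X x y" for x y
      using nonneg diff by (simp add: hdist_def hnorm_def)
    have "hnorm X (x - y) = hnorm X (y - x)" if "x \<in> pts X" "y \<in> pts X" for x y
    proof -
      have a: "y - x \<in> pts X" "x - y \<in> pts X" using diff that by auto
      have "ip X (x - y) (x - y) = ip X (y - x) (y - x)"
        using scale[OF a(1) a(2), of "-1"] scale[OF a(2) a(1), of "-1"] sym[OF a] by simp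
      then show ?thesis by (simp add: hnorm_def)
    qed
    then show "hdist X x y = hdist X y x" for x y
      by (simp add: hdist_def)
    show "hdist X x y = 0 \<longleftrightarrow> x = y" if "x \<in> pts X" "y \<in> pts X" for x y
      using that pos[of "x - y"] diff[of x y] ip0
      by (cases "x = y") (simp_all add: hdist_def hnorm_def)
    show "hdist X x z \<le> hdist X x y + hdist X y z"
      if "x \<in> pts X" "y \<in> pts X" "z \<in> pts X" for x y z
      using tri[of "x - y" "y - z"] that diff by (simp add: hdist_def)
  qed
qed

definition closed_subspace :: "'v::real_vector ip_space \<Rightarrow> 'v set \<Rightarrow> bool" where
  "closed_subspace X W \<longleftrightarrow> subspace W \<and> closedin (htopology X) W"

definition orthogonal_sets :: "'v ip_space \<Rightarrow> 'v set \<Rightarrow> 'v set \<Rightarrow> bool" where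
  "orthogonal_sets X A B \<longleftrightarrow> (\<forall>x\<in>A. \<forall>y\<in>B. ip X x y = 0)"

definition orth_proj :: "'v::real_vector ip_space \<Rightarrow> 'v set \<Rightarrow> 'v \<Rightarrow> 'v" where
  "orth_proj X W x = (THE y. y \<in> W \<and> (\<forall>w\<in>W. ip X (x - y) w = 0))"

definition linear_map_on :: "'v::real_vector set \<Rightarrow> ('v \<Rightarrow> 'w::real_vector) \<Rightarrow> bool" where
  "linear_map_on A F \<longleftrightarrow>
     (\<forall>x\<in>A. \<forall>y\<in>A. F (x + y) = F x + F y) \<and> (\<forall>c. \<forall>x\<in>A. F (c *\<^sub>R x) = c *\<^sub>R F x)"

definition bounded_operator ::
    "'v::real_vector ip_space \<Rightarrow> 'w::real_vector ip_space \<Rightarrow> ('v \<Rightarrow> 'w) \<Rightarrow> bool" where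
  "bounded_operator X Y F \<longleftrightarrow> F ` pts X \<subseteq> pts Y \<and> linear_map_on (pts X) F
     \<and> (\<exists>C. \<forall>x\<in>pts X. hnorm Y (F x) \<le> C * hnorm X x)"

definition opnorm ::
    "'v::real_vector ip_space \<Rightarrow> 'w::real_vector ip_space \<Rightarrow> ('v \<Rightarrow> 'w) \<Rightarrow> real" where
  "opnorm X Y F = (SUP x\<in>pts X. hnorm Y (F x) / hnorm X x)"

definition affine_linear_operator ::
    "'v::real_vector ip_space \<Rightarrow> 'w::real_vector ip_space \<Rightarrow> ('v \<Rightarrow> 'w) \<Rightarrow> bool" where
  "affine_linear_operator X Y T \<longleftrightarrow>
     (\<exists>L c. linear_map_on (pts X) L \<and> L ` pts X \<subseteq> pts Y \<and> c \<in> pts Y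
        \<and> (\<forall>x\<in>pts X. T x = L x + c))"

definition compact_operator ::
    "'v::real_vector ip_space \<Rightarrow> 'w::real_vector ip_space \<Rightarrow> ('v \<Rightarrow> 'w) \<Rightarrow> bool" where
  "compact_operator X Y T \<longleftrightarrow> T ` pts X \<subseteq> pts Y
     \<and> (\<forall>B. Metric_space.mbounded (pts X) (hdist X) B \<longrightarrow>
           compactin (htopology Y) (htopology Y closure_of (T ` B)))"


section \<open>Forms and functionals\<close>

definition bilinear_form :: "'v::real_vector ip_space \<Rightarrow> ('v \<Rightarrow> 'v \<Rightarrow> real) \<Rightarrow> bool" where
  "bilinear_form V a \<longleftrightarrow> (\<forall>y\<in>pts V. linear_map_on (pts V) (\<lambda>x. a x y))
     \<and> (\<forall>x\<in>pts V. linear_map_on (pts V) (a x))"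

definition symmetric_form :: "'v ip_space \<Rightarrow> ('v \<Rightarrow> 'v \<Rightarrow> real) \<Rightarrow> bool" where
  "symmetric_form V a \<longleftrightarrow> (\<forall>x\<in>pts V. \<forall>y\<in>pts V. a x y = a y x)"

definition continuous_form :: "'v ip_space \<Rightarrow> ('v \<Rightarrow> 'v \<Rightarrow> real) \<Rightarrow> bool" where
  "continuous_form V a \<longleftrightarrow>
     (\<exists>C. \<forall>x\<in>pts V. \<forall>y\<in>pts V. \<bar>a x y\<bar> \<le> C * hnorm V x * hnorm V y)"

definition coercivity_const :: "'v::zero ip_space \<Rightarrow> ('v \<Rightarrow> 'v \<Rightarrow> real) \<Rightarrow> real" where
  "coercivity_const V a = (INF x\<in>pts V - {0}. \<bar>a x x\<bar> / (hnorm V x)\<^sup>2)"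

definition continuity_const :: "'v::zero ip_space \<Rightarrow> ('v \<Rightarrow> 'v \<Rightarrow> real) \<Rightarrow> real" where
  "continuity_const V a =
     (SUP (x, y)\<in>(pts V - {0}) \<times> (pts V - {0}). \<bar>a x y\<bar> / (hnorm V x * hnorm V y))"

definition coercive_form :: "'v::zero ip_space \<Rightarrow> ('v \<Rightarrow> 'v \<Rightarrow> real) \<Rightarrow> bool" where
  "coercive_form V a \<longleftrightarrow> 0 < coercivity_const V a"

definition dual_functional :: "'v::real_vector ip_space \<Rightarrow> ('v \<Rightarrow> real) \<Rightarrow> bool" where
  "dual_functional V f \<longleftrightarrow> linear_map_on (pts V) f
     \<and> (\<exists>C. \<forall>x\<in>pts V. \<bar>f x\<bar> \<le> C * hnorm V x)"

definition solves_on :: "'v set \<Rightarrow> ('v \<Rightarrow> 'v \<Rightarrow> real) \<Rightarrow> ('v \<Rightarrow> real) \<Rightarrow> 'v \<Rightarrow> bool" where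
  "solves_on W a f u \<longleftrightarrow> u \<in> W \<and> (\<forall>v\<in>W. a u v = f v)"


section \<open>Localizing space decompositions and training configurations\<close>

text \<open>Both overlapping and non-overlapping decompositions are admitted: the closures of the
  subdomains cover \<open>\<Omega>\<close>, and nothing is required of their intersections.\<close>

definition domain_decomposition :: "'a::euclidean_space set \<Rightarrow> nat \<Rightarrow> (nat \<Rightarrow> 'a set) \<Rightarrow> bool" where
  "domain_decomposition \<Omega> N \<omega> \<longleftrightarrow>
     (\<forall>i\<in>{1..N}. open (\<omega> i) \<and> \<omega> i \<subseteq> \<Omega>) \<and> \<Omega> \<subseteq> closure (\<Union>i\<in>{1..N}. \<omega> i)"

text \<open>
  The sum of the local spaces is the Minkowski sum. Since \<open>supp\<close> is a closed set while the
  subdomains are open, the support condition refers to the closed subdomain, as is needed for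
  local spaces such as \<open>H\<^sup>1\<^sub>0(\<omega>\<^sub>i)\<close>.
\<close>

definition localizing_space_decomposition ::
    "'a::euclidean_space set \<Rightarrow> ('a, 'b::real_vector) ae_fun ip_space \<Rightarrow> nat \<Rightarrow> (nat \<Rightarrow> 'a set) \<Rightarrow>
     (nat \<Rightarrow> ('a, 'b) ae_fun set) \<Rightarrow> (nat \<Rightarrow> ('a, 'b) ae_fun \<Rightarrow> ('a, 'b) ae_fun) \<Rightarrow> bool" where
  "localizing_space_decomposition \<Omega> V N \<omega> Vl PV \<longleftrightarrow>
     open \<Omega> \<and> bounded \<Omega> \<and> connected \<Omega> \<and> \<Omega> \<noteq> {} \<and> smooth_boundary \<Omega>
   \<and> hilbert_space V \<and> (\<forall>\<phi>\<in>pts V. restr \<Omega> \<phi> = \<phi>)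
   \<and> domain_decomposition \<Omega> N \<omega>
   \<and> (\<forall>i\<in>{1..N}. subspace (Vl i) \<and> Vl i \<subseteq> pts V)
   \<and> (\<Sum>i=1..N. Vl i) = pts V
   \<and> (\<forall>i\<in>{1..N}. \<forall>\<phi>\<in>Vl i. supp \<phi> \<subseteq> closure (\<omega> i))
   \<and> (\<forall>i\<in>{1..N}. PV i ` pts V \<subseteq> Vl i \<and> linear_map_on (pts V) (PV i))
   \<and> (\<forall>\<phi>\<in>pts V. (\<Sum>i=1..N. PV i \<phi>) = \<phi>)"

text \<open>The indices split into \<open>J\<close> nonempty classes of pairwise orthogonal local spaces.\<close>

definition orthogonal_classes :: "'v ip_space \<Rightarrow> nat \<Rightarrow> (nat \<Rightarrow> 'v set) \<Rightarrow> nat \<Rightarrow> bool" where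
  "orthogonal_classes V N Vl J \<longleftrightarrow>
     (\<exists>\<P>. partition_on {1..N} \<P> \<and> card \<P> = J
        \<and> (\<forall>K\<in>\<P>. \<forall>i\<in>K. \<forall>j\<in>K. i \<noteq> j \<longrightarrow> orthogonal_sets V (Vl i) (Vl j)))"

definition max_overlap :: "'a set \<Rightarrow> nat \<Rightarrow> (nat \<Rightarrow> 'a set) \<Rightarrow> nat" where
  "max_overlap \<Omega> N \<omega>s = Max ((\<lambda>x. card {i\<in>{1..N}. x \<in> \<omega>s i}) ` \<Omega>)"

text \<open>\<open>R i\<close> is the space of restrictions to the training domain \<open>\<omega>s i\<close>, with its own
  inner product.\<close>

definition localized_training_configuration ::
    "'a::euclidean_space set \<Rightarrow> ('a, 'b::real_vector) ae_fun ip_space \<Rightarrow> nat \<Rightarrow>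
     (nat \<Rightarrow> ('a, 'b) ae_fun set) \<Rightarrow> ('a, 'b) ae_fun \<Rightarrow> (nat \<Rightarrow> 'a set) \<Rightarrow>
     (nat \<Rightarrow> ('a, 'b) ae_fun ip_space) \<Rightarrow> (nat \<Rightarrow> 's::real_vector ip_space) \<Rightarrow>
     (nat \<Rightarrow> ('a, 'b) ae_fun \<Rightarrow> 's) \<Rightarrow> (nat \<Rightarrow> 's \<Rightarrow> ('a, 'b) ae_fun) \<Rightarrow> bool" where
  "localized_training_configuration \<Omega> V N Vl u \<omega>s R S PS T \<longleftrightarrow>
     (\<forall>i\<in>{1..N}. \<omega>s i \<subseteq> \<Omega>)
   \<and> (\<forall>i\<in>{1..N}. hilbert_space (R i) \<and> pts (R i) = restr (\<omega>s i) ` pts V)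
   \<and> (\<Sum>i=1..N. (hnorm (R i) (restr (\<omega>s i) u))\<^sup>2) \<le> real (max_overlap \<Omega> N \<omega>s) * (hnorm V u)\<^sup>2
   \<and> (\<forall>i\<in>{1..N}. hilbert_space (S i))
   \<and> (\<forall>i\<in>{1..N}. bounded_operator (R i) (S i) (PS i))
   \<and> (\<forall>i\<in>{1..N}. affine_linear_operator (S i) (V\<lparr>pts := Vl i\<rparr>) (T i)
                 \<and> compact_operator (S i) (V\<lparr>pts := Vl i\<rparr>) (T i))
   \<and> u = (\<Sum>i=1..N. T i (PS i (restr (\<omega>s i) u)))"

end

theory Submission
  imports Defs
begin

text \<open>
  Let \<open>s\<^sub>i\<close> be the image under \<open>PS i\<close> of the restriction of \<open>u\<close> to the \<open>i\<close>-th training domain, so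
  that \<open>u = \<Sum>\<^sub>i (Tl i s\<^sub>i + Ta i)\<close>, and let \<open>P\<^sub>i\<close> be the orthogonal projection onto \<open>Vt i\<close>. As \<open>Ta i\<close>
  lies in \<open>Vt i\<close>, the element \<open>v = \<Sum>\<^sub>i (P\<^sub>i (Tl i s\<^sub>i) + Ta i)\<close> belongs to the sum of the reduced
  spaces. Its error is \<open>u - v = \<Sum>\<^sub>i e\<^sub>i\<close> with \<open>e\<^sub>i = (1 - P\<^sub>i) (Tl i s\<^sub>i)\<close> in the local space \<open>Vl i\<close>.

  Within an orthogonality class the squared norms of the \<open>e\<^sub>i\<close> add up by Pythagoras, and the \<open>J\<close>
  classes are combined by the Cauchy-Schwarz inequality for sums, whence
  \<open>\<parallel>u - v\<parallel>\<^sup>2 \<le> J \<Sum>\<^sub>i \<parallel>e\<^sub>i\<parallel>\<^sup>2\<close> (\<open>hnorm_sum_orthogonal_classes_le\<close>). Each \<open>\<parallel>e\<^sub>i\<parallel>\<close> is at most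
  \<open>\<parallel>(1 - P\<^sub>i) Tl i\<parallel> \<parallel>PS i\<parallel>\<close> times the norm of the restriction of \<open>u\<close>, and the squares of the norms of
  these restrictions sum to at most \<open>\<parallel>u\<parallel>\<^sup>2\<close> times the maximal overlap. Finally, Galerkin
  orthogonality and the symmetry of the form show that the error of \<open>ut\<close> is at most \<open>sqrt (\<gamma> / \<alpha>)\<close>
  times that of any other element of the sum of the reduced spaces, \<open>v\<close> in particular
  (\<open>Galerkin_quasi_optimal\<close>).

  Two analytic facts support this. The operator norms are suprema of real numbers and bound the
  operators only if these suprema are finite; for \<open>(1 - P\<^sub>i) Tl i\<close> this follows from the compactness
  of \<open>T i\<close> (\<open>compact_operator_linear_part_bounded\<close>). And \<open>P\<^sub>i\<close> is a definite description, whose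
  meaning rests on the projection theorem (\<open>orth_proj_exists\<close>); this is where the completeness of \<open>V\<close>
  enters.
\<close>

section \<open>Inner product spaces on a carrier\<close>

text \<open>An inner product space on a linear subspace of the ambient type, not necessarily complete. It
  is a metric space by its own distance, from which its topology is taken.\<close>

locale carrier_ip_space =
  fixes X :: "'v::real_vector ip_space"
  assumes inner_product_space: "inner_product_space X"
begin

sublocale Metric_space "pts X" "hdist X"
  by (rule inner_product_space_Metric_space[OF inner_product_space])

lemma subspace_pts: "subspace (pts X)"
  using inner_product_space by (simp add: inner_product_space_def)

lemmas pts_0 [simp] = subspace_0[OF subspace_pts]
lemmas pts_add [simp] = subspace_add[OF subspace_pts]
lemmas pts_minus [simp] = subspace_neg[OF subspace_pts]
lemmas pts_diff [simp] = subspace_diff[OF subspace_pts]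
lemmas pts_scale [simp] = subspace_scale[OF subspace_pts]

lemma pts_sum: "(\<And>i. i \<in> I \<Longrightarrow> x i \<in> pts X) \<Longrightarrow> sum x I \<in> pts X"
  by (rule subspace_sum[OF subspace_pts])

lemma ip_commute: "x \<in> pts X \<Longrightarrow> y \<in> pts X \<Longrightarrow> ip X x y = ip X y x"
  using inner_product_space by (simp add: inner_product_space_def)

lemma ip_add_left:
  assumes "x \<in> pts X" "y \<in> pts X" "z \<in> pts X"
  shows "ip X (x + y) z = ip X x z + ip X y z"
proof -
  have "\<forall>x\<in>pts X. \<forall>y\<in>pts X. \<forall>z\<in>pts X. ip X (x + y) z = ip X x z + ip X y z"
    using inner_product_space unfolding inner_product_space_def by (elim conjE)
  then show ?thesis using assms by simp
qed

lemma ip_scale_left: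
  assumes "x \<in> pts X" "y \<in> pts X"
  shows "ip X (c *\<^sub>R x) y = c * ip X x y"
proof -
  have "\<forall>x\<in>pts X. \<forall>y\<in>pts X. \<forall>c. ip X (c *\<^sub>R x) y = c * ip X x y"
    using inner_product_space unfolding inner_product_space_def by (elim conjE)
  then show ?thesis using assms by simp
qed

lemma ip_pos: "x \<in> pts X \<Longrightarrow> x \<noteq> 0 \<Longrightarrow> 0 < ip X x x"
  using inner_product_space by (simp add: inner_product_space_def)

lemma ip_0_left [simp]: "y \<in> pts X \<Longrightarrow> ip X 0 y = 0"
  using ip_scale_left[of 0 y 0] by simp

lemma ip_nonneg: "x \<in> pts X \<Longrightarrow> 0 \<le> ip X x x"
  using ip_pos[of x] by (cases "x = 0") simp_all

lemma ip_diff_left: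
  assumes "x \<in> pts X" "y \<in> pts X" "z \<in> pts X"
  shows "ip X (x - y) z = ip X x z - ip X y z"
  using ip_add_left[of "x - y" y z] assms by simp

lemma ip_add_right:
  assumes "x \<in> pts X" "y \<in> pts X" "z \<in> pts X"
  shows "ip X z (x + y) = ip X z x + ip X z y"
  using ip_add_left[OF assms] assms by (simp add: ip_commute[of z])

lemma ip_diff_right:
  assumes "x \<in> pts X" "y \<in> pts X" "z \<in> pts X"
  shows "ip X z (x - y) = ip X z x - ip X z y"
  using ip_diff_left[OF assms] assms by (simp add: ip_commute[of z])

lemma ip_scale_right: "x \<in> pts X \<Longrightarrow> y \<in> pts X \<Longrightarrow> ip X x (c *\<^sub>R y) = c * ip X x y"
  using ip_scale_left[of y x c] by (simp add: ip_commute[of x])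

lemma hnorm_power2: "x \<in> pts X \<Longrightarrow> (hnorm X x)\<^sup>2 = ip X x x"
  by (simp add: hnorm_def ip_nonneg)

lemma hnorm_nonneg [simp]: "x \<in> pts X \<Longrightarrow> 0 \<le> hnorm X x"
  by (simp add: hnorm_def ip_nonneg)

lemma hnorm_0 [simp]: "hnorm X 0 = 0"
  by (simp add: hnorm_def)

lemma hnorm_pos: "x \<in> pts X \<Longrightarrow> x \<noteq> 0 \<Longrightarrow> 0 < hnorm X x"
  by (simp add: hnorm_def ip_pos)

lemma hnorm_scale: "x \<in> pts X \<Longrightarrow> hnorm X (c *\<^sub>R x) = \<bar>c\<bar> * hnorm X x"
  by (simp add: hnorm_def ip_scale_left ip_scale_right real_sqrt_mult flip: mult.assoc)

lemma hnorm_minus [simp]: "x \<in> pts X \<Longrightarrow> hnorm X (- x) = hnorm X x"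
  using hnorm_scale[of x "- 1"] by simp

lemma hnorm_triangle:
  assumes "x \<in> pts X" "y \<in> pts X"
  shows "hnorm X (x + y) \<le> hnorm X x + hnorm X y"
  using triangle[of "x + y" y 0] assms by (simp add: hdist_def)

lemma hnorm_minus_commute: "x \<in> pts X \<Longrightarrow> y \<in> pts X \<Longrightarrow> hnorm X (x - y) = hnorm X (y - x)"
  using commute[of x y] by (simp add: hdist_def)

lemma hnorm_sum_le:
  assumes "\<And>i. i \<in> I \<Longrightarrow> x i \<in> pts X"
  shows "hnorm X (\<Sum>i\<in>I. x i) \<le> (\<Sum>i\<in>I. hnorm X (x i))"
  using assms
proof (induction I rule: infinite_finite_induct)
  case (insert j I)
  then have "hnorm X (x j + (\<Sum>i\<in>I. x i)) \<le> hnorm X (x j) + hnorm X (\<Sum>i\<in>I. x i)"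
    by (intro hnorm_triangle pts_sum) auto
  also have "hnorm X (\<Sum>i\<in>I. x i) \<le> (\<Sum>i\<in>I. hnorm X (x i))"
    using insert by simp
  finally show ?case
    using insert by simp
qed simp_all

lemma subspace_ip_space:
  assumes "subspace W" "W \<subseteq> pts X"
  shows "carrier_ip_space (X\<lparr>pts := W\<rparr>)"
  using assms inner_product_space
  by (unfold_locales) (auto simp: inner_product_space_def subset_iff)


section \<open>The projection theorem\<close>

lemma parallelogram_midpoint:
  assumes "x \<in> pts X" "y \<in> pts X" "z \<in> pts X"
  shows "(hnorm X (y - z))\<^sup>2 = 2 * (hnorm X (x - y))\<^sup>2 + 2 * (hnorm X (x - z))\<^sup>2
           - 4 * (hnorm X (x - (1/2) *\<^sub>R (y + z)))\<^sup>2"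
  using assms
  by (simp add: hnorm_power2 ip_diff_left ip_diff_right ip_add_left ip_add_right
      ip_scale_left ip_scale_right ip_commute[of y x] ip_commute[of z x] ip_commute[of z y]
      field_simps)

lemma nearest_point_orthogonal:
  assumes z: "z \<in> pts X" and w: "w \<in> pts X"
    and min: "\<And>t. (hnorm X z)\<^sup>2 \<le> (hnorm X (z - t *\<^sub>R w))\<^sup>2"
  shows "ip X z w = 0"
proof (cases "w = 0")
  case True
  then show ?thesis
    using z ip_commute[of z 0] by simp
next
  case False
  \<comment> \<open>This \<open>t\<close> minimizes the squared norm of \<open>z - t *\<^sub>R w\<close>.\<close>
  define t where "t = ip X z w / ip X w w"
  have ww: "0 < ip X w w"
    using False w by (rule ip_pos[rotated])
  have "(hnorm X (z - t *\<^sub>R w))\<^sup>2 = ip X z z - 2 * t * ip X z w + t * t * ip X w w"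
    using z w
    by (simp add: hnorm_power2 ip_diff_left ip_diff_right ip_scale_left ip_scale_right
        ip_commute[of w z] algebra_simps)
  also have "\<dots> = (hnorm X z)\<^sup>2 - (ip X z w)\<^sup>2 / ip X w w"
    unfolding hnorm_power2[OF z] using ww by (simp add: t_def power2_eq_square field_simps)
  finally have "(ip X z w)\<^sup>2 / ip X w w \<le> 0"
    using min[of t] by simp
  then show ?thesis
    using ww by (simp add: divide_le_0_iff)
qed

text \<open>A sequence in \<open>W\<close> whose distances to \<open>x\<close> tend to the infimum is Cauchy by the
  parallelogram law; its limit is the projection of \<open>x\<close>.\<close>

lemma orth_proj_exists:
  assumes complete: "mcomplete" and W: "closed_subspace X W" and x: "x \<in> pts X"
  shows "\<exists>y\<in>W. \<forall>w\<in>W. ip X (x - y) w = 0"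
proof -
  have sW: "subspace W" and cW: "closedin mtopology W"
    using W by (auto simp: closed_subspace_def)
  have WX: "W \<subseteq> pts X"
    using closedin_subset[OF cW] by simp
  define \<delta> where "\<delta> = (INF w\<in>W. (hnorm X (x - w))\<^sup>2)"
  have bdd: "bdd_below ((\<lambda>w. (hnorm X (x - w))\<^sup>2) ` W)"
    by (rule bdd_belowI[of _ 0]) auto
  have \<delta>_le: "\<delta> \<le> (hnorm X (x - w))\<^sup>2" if "w \<in> W" for w
    unfolding \<delta>_def by (rule cINF_lower[OF bdd that])
  have "\<exists>w\<in>W. (hnorm X (x - w))\<^sup>2 < \<delta> + 1 / real (Suc n)" for n
  proof -
    have "\<delta> < \<delta> + 1 / real (Suc n)" by simp
    then show ?thesis
      unfolding \<delta>_def using subspace_0[OF sW] bdd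
      by (subst (asm) cINF_less_iff) auto
  qed
  then obtain \<sigma> where \<sigma>W: "\<And>n. \<sigma> n \<in> W"
    and \<sigma>: "\<And>n. (hnorm X (x - \<sigma> n))\<^sup>2 < \<delta> + 1 / real (Suc n)"
    by metis
  have \<sigma>X: "\<sigma> n \<in> pts X" for n
    using \<sigma>W WX by auto
  have dist: "(hnorm X (\<sigma> m - \<sigma> n))\<^sup>2 < 2 / real (Suc m) + 2 / real (Suc n)" for m n
  proof -
    have mid: "(1/2) *\<^sub>R (\<sigma> m + \<sigma> n) \<in> W"
      using sW \<sigma>W by (intro subspace_scale subspace_add)
    show ?thesis
      using parallelogram_midpoint[OF x \<sigma>X[of m] \<sigma>X[of n]] \<delta>_le[OF mid] \<sigma>[of m] \<sigma>[of n]
      by simp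
  qed
  have "MCauchy \<sigma>"
    unfolding MCauchy_def
  proof (intro conjI allI impI)
    show "range \<sigma> \<subseteq> pts X" using \<sigma>X by auto
    fix \<epsilon> :: real assume \<epsilon>: "0 < \<epsilon>"
    obtain N where N: "1 / real (Suc N) < \<epsilon>\<^sup>2 / 4"
      using \<epsilon> reals_Archimedean[of "\<epsilon>\<^sup>2 / 4"] by (auto simp: inverse_eq_divide)
    have "hdist X (\<sigma> m) (\<sigma> n) < \<epsilon>" if "N \<le> m" "N \<le> n" for m n
    proof -
      have "1 / real (Suc m) \<le> 1 / real (Suc N)" "1 / real (Suc n) \<le> 1 / real (Suc N)"
        using that by (auto intro!: divide_left_mono)
      then have "(hnorm X (\<sigma> m - \<sigma> n))\<^sup>2 < \<epsilon>\<^sup>2"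
        using dist[of m n] N by simp
      then show ?thesis
        using \<epsilon> \<sigma>X by (simp add: hdist_def power_less_imp_less_base)
    qed
    then show "\<exists>N. \<forall>m n. N \<le> m \<longrightarrow> N \<le> n \<longrightarrow> hdist X (\<sigma> m) (\<sigma> n) < \<epsilon>"
      by blast
  qed
  then obtain y where lim: "limitin mtopology \<sigma> y sequentially"
    using complete by (auto simp: mcomplete_def)
  have yW: "y \<in> W"
    using limitin_closedin[OF lim cW] \<sigma>W by simp
  have yX: "y \<in> pts X"
    using yW WX by auto
  have to0: "(\<lambda>n. hnorm X (\<sigma> n - y)) \<longlonglongrightarrow> 0"
    using lim \<sigma>X yX by (simp add: limitin_metric_dist_null hdist_def)
  have "(\<lambda>n. (sqrt (\<delta> + 1 / real (Suc n)) + hnorm X (\<sigma> n - y))\<^sup>2) \<longlonglongrightarrow> (sqrt (\<delta> + 0) + 0)\<^sup>2"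
    by (intro tendsto_intros to0 LIMSEQ_Suc[OF lim_1_over_n])
  moreover have "(hnorm X (x - y))\<^sup>2 \<le> (sqrt (\<delta> + 1 / real (Suc n)) + hnorm X (\<sigma> n - y))\<^sup>2" for n
  proof (rule power_mono)
    have "hnorm X (x - y) \<le> hnorm X (x - \<sigma> n) + hnorm X (\<sigma> n - y)"
      using hnorm_triangle[of "x - \<sigma> n" "\<sigma> n - y"] x yX \<sigma>X by simp
    also have "hnorm X (x - \<sigma> n) \<le> sqrt (\<delta> + 1 / real (Suc n))"
      using \<sigma>[of n] by (intro real_le_rsqrt) simp
    finally show "hnorm X (x - y) \<le> sqrt (\<delta> + 1 / real (Suc n)) + hnorm X (\<sigma> n - y)"
      by simp
    show "0 \<le> hnorm X (x - y)" using x yX by simp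
  qed
  ultimately have "(hnorm X (x - y))\<^sup>2 \<le> (sqrt (\<delta> + 0) + 0)\<^sup>2"
    by (intro LIMSEQ_le_const) auto
  moreover have "0 \<le> \<delta>"
    unfolding \<delta>_def using subspace_0[OF sW] by (intro cINF_greatest) auto
  ultimately have y_min: "(hnorm X (x - y))\<^sup>2 \<le> \<delta>"
    by simp
  have "ip X (x - y) w = 0" if w: "w \<in> W" for w
  proof (rule nearest_point_orthogonal)
    show "x - y \<in> pts X" "w \<in> pts X" using x yX w WX by auto
    fix t
    have "y + t *\<^sub>R w \<in> W"
      using sW yW w by (intro subspace_add subspace_scale)
    from \<delta>_le[OF this] show "(hnorm X (x - y))\<^sup>2 \<le> (hnorm X (x - y - t *\<^sub>R w))\<^sup>2"
      using y_min by (simp add: diff_diff_eq)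
  qed
  with yW show ?thesis by blast
qed

lemma
  assumes complete: "mcomplete" and W: "closed_subspace X W" and x: "x \<in> pts X"
  shows orth_proj_in: "orth_proj X W x \<in> W"
    and orth_proj_orthogonal: "w \<in> W \<Longrightarrow> ip X (x - orth_proj X W x) w = 0"
proof -
  have sW: "subspace W" and cW: "closedin mtopology W"
    using W by (auto simp: closed_subspace_def)
  have WX: "W \<subseteq> pts X"
    using closedin_subset[OF cW] by simp
  have unique: "y = z" if y: "y \<in> W" "\<forall>w\<in>W. ip X (x - y) w = 0"
    and z: "z \<in> W" "\<forall>w\<in>W. ip X (x - z) w = 0" for y z
  proof -
    have yz: "y - z \<in> W" using sW y z by (intro subspace_diff)
    have yX: "y \<in> pts X" and zX: "z \<in> pts X" using y z WX by auto
    have "ip X (x - z) (y - z) - ip X (x - y) (y - z) = ip X (y - z) (y - z)"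
      using x yX zX by (subst ip_diff_left[symmetric]) simp_all
    then have "ip X (y - z) (y - z) = 0"
      using y z yz by simp
    then show ?thesis
      using ip_pos[of "y - z"] yX zX by (cases "y = z") simp_all
  qed
  obtain y where y: "y \<in> W" "\<forall>w\<in>W. ip X (x - y) w = 0"
    using orth_proj_exists[OF assms] by blast
  have "\<exists>!y. y \<in> W \<and> (\<forall>w\<in>W. ip X (x - y) w = 0)"
  proof (rule ex1I)
    show "y \<in> W \<and> (\<forall>w\<in>W. ip X (x - y) w = 0)"
      using y by simp
    show "z = y" if "z \<in> W \<and> (\<forall>w\<in>W. ip X (x - z) w = 0)" for z
      using that by (intro unique[OF _ _ y]) simp_all
  qed
  from theI'[OF this]
  show "orth_proj X W x \<in> W" "w \<in> W \<Longrightarrow> ip X (x - orth_proj X W x) w = 0"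
    by (auto simp: orth_proj_def)
qed

lemma hnorm_minus_orth_proj_le:
  assumes complete: "mcomplete" and W: "closed_subspace X W" and x: "x \<in> pts X"
  shows "hnorm X (x - orth_proj X W x) \<le> hnorm X x"
proof -
  define p where "p = orth_proj X W x"
  have pW: "p \<in> W"
    unfolding p_def by (rule orth_proj_in[OF assms])
  have orth: "ip X (x - p) p = 0"
    using orth_proj_orthogonal[OF assms pW] by (simp only: p_def)
  have "closedin mtopology W"
    using W by (simp add: closed_subspace_def)
  then have p: "p \<in> pts X"
    using closedin_subset pW by fastforce
  define e where "e = x - p"
  have e: "e \<in> pts X" and xe: "x = e + p"
    using x p by (auto simp: e_def)
  have ep: "ip X e p = 0" "ip X p e = 0"
    using orth ip_commute[OF p e] by (simp_all add: e_def)
  have "ip X x x = ip X e e + ip X p p"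
    unfolding xe by (simp add: ip_add_left ip_add_right e p ep)
  then have "(hnorm X (x - p))\<^sup>2 \<le> (hnorm X x)\<^sup>2"
    using x e ip_nonneg[OF p] unfolding e_def[symmetric] by (simp add: hnorm_power2)
  then have "hnorm X (x - p) \<le> hnorm X x"
    by (rule power2_le_imp_le) (rule hnorm_nonneg[OF x])
  then show ?thesis
    by (simp only: p_def)
qed


section \<open>Sums of orthogonal elements\<close>

lemma hnorm_sum_pairwise_orthogonal:
  assumes "finite I" "\<And>i. i \<in> I \<Longrightarrow> x i \<in> pts X"
    and "\<And>i j. i \<in> I \<Longrightarrow> j \<in> I \<Longrightarrow> i \<noteq> j \<Longrightarrow> ip X (x i) (x j) = 0"
  shows "(hnorm X (\<Sum>i\<in>I. x i))\<^sup>2 = (\<Sum>i\<in>I. (hnorm X (x i))\<^sup>2)"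
  using assms
proof (induction I rule: finite_induct)
  case (insert j I)
  have xj: "x j \<in> pts X" and xI: "(\<Sum>i\<in>I. x i) \<in> pts X"
    using insert by (auto intro: pts_sum)
  have "ip X (\<Sum>i\<in>K. x i) (x j) = (\<Sum>i\<in>K. ip X (x i) (x j))" if "finite K" "K \<subseteq> I" for K
    using that
  proof (induction K rule: finite_induct)
    case (insert k K)
    have "x k \<in> pts X" "(\<Sum>i\<in>K. x i) \<in> pts X"
      using insert.prems \<open>\<And>i. i \<in> insert j I \<Longrightarrow> x i \<in> pts X\<close> by (auto intro!: pts_sum)
    then show ?case
      using insert xj by (simp add: ip_add_left)
  qed (use xj in simp)
  from this[OF \<open>finite I\<close> subset_refl] have "ip X (\<Sum>i\<in>I. x i) (x j) = 0"
    using insert by (force intro!: sum.neutral)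
  then have "(hnorm X (x j + (\<Sum>i\<in>I. x i)))\<^sup>2 = (hnorm X (x j))\<^sup>2 + (hnorm X (\<Sum>i\<in>I. x i))\<^sup>2"
    using xj xI ip_commute[OF xj xI] by (simp add: hnorm_power2 ip_add_left ip_add_right)
  then show ?case
    using insert by simp
qed simp

text \<open>The factor is the number of classes rather than the number of summands: the triangle inequality
  is needed only between different classes.\<close>

lemma hnorm_sum_orthogonal_classes_le:
  assumes classes: "orthogonal_classes X N Vl J"
    and sub: "\<And>i. i \<in> {1..N} \<Longrightarrow> Vl i \<subseteq> pts X"
    and e: "\<And>i. i \<in> {1..N} \<Longrightarrow> e i \<in> Vl i"
  shows "(hnorm X (\<Sum>i=1..N. e i))\<^sup>2 \<le> real J * (\<Sum>i=1..N. (hnorm X (e i))\<^sup>2)"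
proof -
  obtain \<P> where part: "partition_on {1..N} \<P>" and card: "card \<P> = J"
    and orth: "\<And>K i j. K \<in> \<P> \<Longrightarrow> i \<in> K \<Longrightarrow> j \<in> K \<Longrightarrow> i \<noteq> j \<Longrightarrow> orthogonal_sets X (Vl i) (Vl j)"
    using classes unfolding orthogonal_classes_def by blast
  have K_sub: "K \<subseteq> {1..N}" if "K \<in> \<P>" for K
    using part that by (auto simp: partition_on_def)
  have fin: "finite K" if "K \<in> \<P>" for K
    using K_sub[OF that] by (rule finite_subset) simp
  have eX: "e i \<in> pts X" if "K \<in> \<P>" "i \<in> K" for K i
    using K_sub that e sub by blast
  have split: "(\<Sum>i=1..N. g i) = (\<Sum>K\<in>\<P>. \<Sum>i\<in>K. g i)" for g :: "nat \<Rightarrow> 'c::comm_monoid_add"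
  proof -
    have "sum g (\<Union>\<P>) = (\<Sum>K\<in>\<P>. sum g K)"
      using part fin by (subst sum.Union_disjoint) (auto simp: partition_on_def disjoint_def)
    then show ?thesis
      using part by (simp add: partition_on_def)
  qed
  have "(hnorm X (\<Sum>i=1..N. e i))\<^sup>2 \<le> (\<Sum>K\<in>\<P>. hnorm X (\<Sum>i\<in>K. e i))\<^sup>2"
    unfolding split using eX
    by (intro power_mono hnorm_sum_le hnorm_nonneg pts_sum) auto
  also have "\<dots> \<le> (\<Sum>K\<in>\<P>. (hnorm X (\<Sum>i\<in>K. e i))\<^sup>2) * real (card \<P>)"
    by (rule sum_squared_le_sum_of_squares)
  also have "\<dots> = real J * (\<Sum>K\<in>\<P>. (hnorm X (\<Sum>i\<in>K. e i))\<^sup>2)"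
    by (simp add: card)
  also have "(\<Sum>K\<in>\<P>. (hnorm X (\<Sum>i\<in>K. e i))\<^sup>2) = (\<Sum>K\<in>\<P>. \<Sum>i\<in>K. (hnorm X (e i))\<^sup>2)"
  proof (intro sum.cong refl hnorm_sum_pairwise_orthogonal)
    fix K i j assume K: "K \<in> \<P>" "i \<in> K" "j \<in> K" "i \<noteq> j"
    then have "e i \<in> Vl i" "e j \<in> Vl j"
      using e K_sub by blast+
    then show "ip X (e i) (e j) = 0"
      using orth[OF K] unfolding orthogonal_sets_def by blast
  qed (use fin eX in auto)
  finally show ?thesis
    by (simp only: split)
qed


section \<open>Quasi-optimality of Galerkin approximations\<close>

lemma coercivity_const_le:
  assumes x: "x \<in> pts X"
  shows "coercivity_const X a * (hnorm X x)\<^sup>2 \<le> \<bar>a x x\<bar>"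
proof (cases "x = 0")
  case False
  have "bdd_below ((\<lambda>x. \<bar>a x x\<bar> / (hnorm X x)\<^sup>2) ` (pts X - {0}))"
    by (rule bdd_belowI[of _ 0]) auto
  then have "coercivity_const X a \<le> \<bar>a x x\<bar> / (hnorm X x)\<^sup>2"
    unfolding coercivity_const_def using x False by (intro cINF_lower) auto
  then show ?thesis
    using hnorm_pos[OF x False] by (simp add: field_simps)
qed simp

lemma continuity_const_ge:
  assumes cont: "continuous_form X a" and bil: "bilinear_form X a"
    and x: "x \<in> pts X" and y: "y \<in> pts X"
  shows "\<bar>a x y\<bar> \<le> continuity_const X a * hnorm X x * hnorm X y"
proof (cases "x = 0 \<or> y = 0")
  case True
  obtain C where "\<bar>a x y\<bar> \<le> C * hnorm X x * hnorm X y"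
    using cont x y unfolding continuous_form_def by blast
  then show ?thesis
    using True by auto
next
  case False
  obtain C where C: "\<And>x y. x \<in> pts X \<Longrightarrow> y \<in> pts X \<Longrightarrow> \<bar>a x y\<bar> \<le> C * hnorm X x * hnorm X y"
    using cont unfolding continuous_form_def by blast
  have "bdd_above ((\<lambda>(x, y). \<bar>a x y\<bar> / (hnorm X x * hnorm X y)) ` ((pts X - {0}) \<times> (pts X - {0})))"
  proof (rule bdd_aboveI2)
    fix p assume "p \<in> (pts X - {0}) \<times> (pts X - {0})"
    then obtain x y where p: "p = (x, y)" and *: "x \<in> pts X" "y \<in> pts X" "x \<noteq> 0" "y \<noteq> 0"
      by auto
    then have "0 < hnorm X x * hnorm X y"
      by (simp add: hnorm_pos)
    then show "(case p of (x, y) \<Rightarrow> \<bar>a x y\<bar> / (hnorm X x * hnorm X y)) \<le> C"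
      using C[OF *(1,2)] by (simp add: p divide_le_eq mult.assoc)
  qed
  then have "(case (x, y) of (x, y) \<Rightarrow> \<bar>a x y\<bar> / (hnorm X x * hnorm X y)) \<le> continuity_const X a"
    unfolding continuity_const_def using x y False by (intro cSUP_upper) auto
  moreover have "0 < hnorm X x * hnorm X y"
    using x y False by (simp add: hnorm_pos)
  ultimately show ?thesis
    by (simp add: divide_le_eq mult.assoc)
qed

text \<open>Coercivity bounds the absolute value of the quadratic form, which may thus be negative
  definite; at two vectors that are orthogonal with respect to the form it cannot take opposite
  signs, since it would then vanish at a nonzero combination \<open>x + t *\<^sub>R y\<close>.\<close>

lemma coercive_form_same_sign:
  assumes a: "bilinear_form X a" "symmetric_form X a" "coercive_form X a"
    and x: "x \<in> pts X" and y: "y \<in> pts X" and xy: "a x y = 0"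
  shows "0 \<le> a x x * a y y"
proof (rule ccontr)
  assume "\<not> ?thesis"
  then have neg: "a x x * a y y < 0" by simp
  have add: "a (v + w) z = a v z + a w z" "a z (v + w) = a z v + a z w"
    and scale: "a (c *\<^sub>R v) z = c * a v z" "a z (c *\<^sub>R v) = c * a z v"
    if "v \<in> pts X" "w \<in> pts X" "z \<in> pts X" for v w z c
    using a(1) that by (auto simp: bilinear_form_def linear_map_on_def)
  have yx: "a y x = 0"
    using a(2) x y xy by (simp add: symmetric_form_def)
  \<comment> \<open>As the mixed terms vanish, this \<open>t\<close> makes the form vanish at \<open>x + t *\<^sub>R y\<close>.\<close>
  define t where "t = sqrt (- (a x x / a y y))"
  have ay: "a y y \<noteq> 0" using neg by auto
  have "a x x / a y y < 0"
    using neg by (auto simp: divide_less_0_iff mult_less_0_iff)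
  then have "t * t = - (a x x / a y y)"
    by (simp only: t_def real_sqrt_mult_self abs_of_pos neg_0_less_iff_less)
  then have t2: "t * t * a y y = - a x x"
    using ay by simp
  have ty: "t *\<^sub>R y \<in> pts X" and xty: "x + t *\<^sub>R y \<in> pts X" using x y by auto
  have "a (x + t *\<^sub>R y) (x + t *\<^sub>R y) = a x x + t * t * a y y"
    using add[OF x ty xty] add[OF x ty x] add[OF x ty ty] scale[OF y y x] scale[OF y y ty]
      scale[OF y y y] xy yx by simp
  then have "a (x + t *\<^sub>R y) (x + t *\<^sub>R y) = 0"
    using t2 by simp
  then have "(hnorm X (x + t *\<^sub>R y))\<^sup>2 \<le> 0"
    using coercivity_const_le[OF xty, of a] a(3)
    by (simp add: coercive_form_def mult_le_0_iff)
  then have "x + t *\<^sub>R y = 0"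
    using hnorm_pos[OF xty] by fastforce
  then have "x = (- t) *\<^sub>R y"
    by (simp add: eq_neg_iff_add_eq_0)
  then have "a x x = (- t) * a x y"
    using scale(2)[OF y y x, of "- t"] by simp
  then show False
    using xy neg by simp
qed

text \<open>Cea's lemma for symmetric forms, where the constant improves from \<open>\<gamma> / \<alpha>\<close> to its square root:
  by Galerkin orthogonality the energy of \<open>u - v\<close> is the sum of those of \<open>u - ut\<close> and \<open>ut - v\<close>, which
  do not have opposite signs.\<close>

lemma Galerkin_quasi_optimal:
  assumes a: "bilinear_form X a" "symmetric_form X a" "coercive_form X a" "continuous_form X a"
    and W: "subspace W" "W \<subseteq> pts X"
    and u: "solves_on (pts X) a f u" and ut: "solves_on W a f ut" and v: "v \<in> W"
  shows "hnorm X (u - ut) \<le> sqrt (continuity_const X a / coercivity_const X a) * hnorm X (u - v)"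
proof -
  define e w where "e = u - ut" and "w = ut - v"
  have uX: "u \<in> pts X" and utW: "ut \<in> W"
    using u ut by (auto simp: solves_on_def)
  have wW: "w \<in> W"
    unfolding w_def using W(1) utW v by (rule subspace_diff)
  have eX: "e \<in> pts X" and wX: "w \<in> pts X" and ew: "e + w = u - v"
    using uX utW wW W(2) by (auto simp: e_def w_def)
  have add: "a (x + y) z = a x z + a y z" "a z (x + y) = a z x + a z y"
    if "x \<in> pts X" "y \<in> pts X" "z \<in> pts X" for x y z
    using a(1) that by (auto simp: bilinear_form_def linear_map_on_def)
  have Galerkin: "a e w = 0"
    using add(1)[of e ut w] eX wX utW W(2) wW u ut by (auto simp: e_def solves_on_def)
  then have we: "a w e = 0"
    using a(2) eX wX by (simp add: symmetric_form_def)
  have ewX: "e + w \<in> pts X" using eX wX by simp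
  have "a (e + w) (e + w) = a e e + a w w"
    using add[OF eX wX ewX] add[OF eX wX eX] add[OF eX wX wX] Galerkin we by simp
  moreover have "0 \<le> a e e * a w w"
    by (rule coercive_form_same_sign[OF a(1-3) eX wX Galerkin])
  ultimately have "\<bar>a e e\<bar> \<le> \<bar>a (e + w) (e + w)\<bar>"
    by (auto simp: zero_le_mult_iff)
  also have "\<dots> \<le> continuity_const X a * (hnorm X (e + w))\<^sup>2"
    using continuity_const_ge[OF a(4,1) ewX ewX] by (simp add: power2_eq_square mult.assoc)
  finally have "coercivity_const X a * (hnorm X e)\<^sup>2 \<le> continuity_const X a * (hnorm X (e + w))\<^sup>2"
    using coercivity_const_le[OF eX, of a] by linarith
  then have "(hnorm X e)\<^sup>2 \<le> continuity_const X a / coercivity_const X a * (hnorm X (e + w))\<^sup>2"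
    using a(3) by (simp add: coercive_form_def field_simps)
  then have "hnorm X e \<le> sqrt (continuity_const X a / coercivity_const X a * (hnorm X (e + w))\<^sup>2)"
    by (rule real_le_rsqrt)
  also have "\<dots> = sqrt (continuity_const X a / coercivity_const X a) * hnorm X (e + w)"
    using ewX by (simp only: real_sqrt_mult real_sqrt_abs abs_of_nonneg hnorm_nonneg)
  finally show ?thesis
    unfolding ew by (simp only: e_def)
qed

end


section \<open>Operator norms\<close>

text \<open>The quotient at \<open>x = 0\<close> is \<open>0\<close> by the convention for division, so it does not affect the supremum.
  Linearity of \<open>F\<close> plays no role; the bound \<open>C\<close> only makes the supremum finite.\<close>

lemma
  assumes X: "carrier_ip_space X" and Y: "carrier_ip_space Y"
    and F: "\<And>x. x \<in> pts X \<Longrightarrow> F x \<in> pts Y"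
    and C: "\<And>x. x \<in> pts X \<Longrightarrow> hnorm Y (F x) \<le> C * hnorm X x"
  shows hnorm_le_opnorm: "x \<in> pts X \<Longrightarrow> hnorm Y (F x) \<le> opnorm X Y F * hnorm X x"
    and opnorm_nonneg: "0 \<le> opnorm X Y F"
proof -
  interpret X: carrier_ip_space X by (rule X)
  interpret Y: carrier_ip_space Y by (rule Y)
  have "bdd_above ((\<lambda>x. hnorm Y (F x) / hnorm X x) ` pts X)"
  proof (rule bdd_aboveI[of _ "\<bar>C\<bar>"], clarsimp)
    fix x assume x: "x \<in> pts X"
    have "C * hnorm X x \<le> \<bar>C\<bar> * hnorm X x"
      using x by (intro mult_right_mono) auto
    with C[OF x] have "hnorm Y (F x) \<le> \<bar>C\<bar> * hnorm X x"
      by (rule order_trans)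
    then show "hnorm Y (F x) / hnorm X x \<le> \<bar>C\<bar>"
      using X.hnorm_pos[OF x] by (cases "x = 0") (simp_all add: divide_le_eq)
  qed
  then have upper: "hnorm Y (F x) / hnorm X x \<le> opnorm X Y F" if "x \<in> pts X" for x
    unfolding opnorm_def using that by (rule cSUP_upper[rotated])
  show "0 \<le> opnorm X Y F"
    using upper[of 0] by simp
  show "hnorm Y (F x) \<le> opnorm X Y F * hnorm X x" if x: "x \<in> pts X"
  proof (cases "x = 0")
    case True
    then show ?thesis using C[OF x] by simp
  next
    case False
    then show ?thesis
      using upper[OF x] X.hnorm_pos[OF x] by (simp add: divide_le_eq)
  qed
qed

lemma compact_operator_bounded_on_ball:
  assumes X: "carrier_ip_space X" and Y: "carrier_ip_space Y" and T: "compact_operator X Y T"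
  shows "\<exists>B. \<forall>x\<in>pts X. hnorm X x \<le> 1 \<longrightarrow> hnorm Y (T x) \<le> B"
proof -
  interpret X: carrier_ip_space X by (rule X)
  interpret Y: carrier_ip_space Y by (rule Y)
  define B where "B = {x \<in> pts X. hnorm X x \<le> 1}"
  have TB: "T ` B \<subseteq> pts Y"
    using T by (auto simp: compact_operator_def B_def)
  have "B \<subseteq> X.mcball 0 1"
    by (auto simp: B_def hdist_def)
  then have "X.mbounded B"
    unfolding X.mbounded_def by blast
  then have "compactin Y.mtopology (Y.mtopology closure_of (T ` B))"
    using T by (simp add: compact_operator_def)
  then have "Y.mbounded (Y.mtopology closure_of (T ` B))"
    by (rule Y.compactin_imp_mbounded)
  moreover have "T ` B \<subseteq> Y.mtopology closure_of (T ` B)"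
    using TB by (intro closure_of_subset) simp
  ultimately have "Y.mbounded (T ` B)"
    by (rule Y.mbounded_subset)
  then obtain c r where c: "T ` B \<subseteq> Y.mcball c r"
    unfolding Y.mbounded_def by blast
  have "hnorm Y (T x) \<le> r + hnorm Y c" if "x \<in> pts X" "hnorm X x \<le> 1" for x
  proof -
    have "T x \<in> Y.mcball c r" using c that by (auto simp: B_def)
    then have *: "c \<in> pts Y" "T x \<in> pts Y" "hnorm Y (c - T x) \<le> r"
      by (auto simp: hdist_def)
    then show ?thesis
      using Y.hnorm_triangle[of "T x - c" c] Y.hnorm_minus_commute[of c "T x"] by simp
  qed
  then show ?thesis by blast
qed

lemma compact_operator_linear_part_bounded:
  assumes X: "carrier_ip_space X" and Y: "carrier_ip_space Y" and T: "compact_operator X Y T"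
    and L: "linear_map_on (pts X) L" and c: "c \<in> pts Y"
    and TL: "\<And>x. x \<in> pts X \<Longrightarrow> T x = L x + c"
  shows "\<exists>C. \<forall>x\<in>pts X. hnorm Y (L x) \<le> C * hnorm X x"
proof -
  interpret X: carrier_ip_space X by (rule X)
  interpret Y: carrier_ip_space Y by (rule Y)
  obtain B where B: "\<And>x. x \<in> pts X \<Longrightarrow> hnorm X x \<le> 1 \<Longrightarrow> hnorm Y (T x) \<le> B"
    using compact_operator_bounded_on_ball[OF X Y T] by blast
  have LX: "L x \<in> pts Y" if "x \<in> pts X" for x
    using TL[OF that] T that c Y.pts_diff[of "T x" c] by (auto simp: compact_operator_def)
  have scale: "L (r *\<^sub>R x) = r *\<^sub>R L x" if "x \<in> pts X" for r x
    using L that by (simp add: linear_map_on_def)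
  have "hnorm Y (L x) \<le> (B + hnorm Y c) * hnorm X x" if x: "x \<in> pts X" for x
  proof (cases "x = 0")
    case True
    then show ?thesis using scale[OF x, of 0] by simp
  next
    case False
    then have pos: "0 < hnorm X x" using x by (simp add: X.hnorm_pos)
    define y where "y = (1 / hnorm X x) *\<^sub>R x"
    have y: "y \<in> pts X" "hnorm X y \<le> 1"
      using x pos by (auto simp: y_def X.hnorm_scale)
    have "hnorm Y (L y) \<le> hnorm Y (L y + c) + hnorm Y c"
      using Y.hnorm_triangle[of "L y + c" "- c"] c LX[OF y(1)] by simp
    also have "hnorm Y (L y + c) \<le> B"
      using B[OF y] TL[OF y(1)] by simp
    finally have "hnorm Y (L x) / hnorm X x \<le> B + hnorm Y c"
      using pos x LX[OF x] by (simp add: y_def scale Y.hnorm_scale)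
    then show ?thesis
      using pos by (simp add: divide_le_eq)
  qed
  then show ?thesis by blast
qed


section \<open>The a priori error estimate\<close>

theorem proposition5p1p3:
  fixes \<Omega> :: "(real ^ 'd) set"
    and V :: "(real ^ 'd, 'b::real_vector) ae_fun ip_space"
    and N J :: nat
    and \<omega> \<omega>s :: "nat \<Rightarrow> (real ^ 'd) set"
    and Vl Vt :: "nat \<Rightarrow> (real ^ 'd, 'b) ae_fun set"
    and PV :: "nat \<Rightarrow> (real ^ 'd, 'b) ae_fun \<Rightarrow> (real ^ 'd, 'b) ae_fun"
    and a :: "(real ^ 'd, 'b) ae_fun \<Rightarrow> (real ^ 'd, 'b) ae_fun \<Rightarrow> real"
    and f :: "(real ^ 'd, 'b) ae_fun \<Rightarrow> real"
    and u ut :: "(real ^ 'd, 'b) ae_fun"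
    and R :: "nat \<Rightarrow> (real ^ 'd, 'b) ae_fun ip_space"
    and S :: "nat \<Rightarrow> 's::real_vector ip_space"
    and PS :: "nat \<Rightarrow> (real ^ 'd, 'b) ae_fun \<Rightarrow> 's"
    and T Tl :: "nat \<Rightarrow> 's \<Rightarrow> (real ^ 'd, 'b) ae_fun"
    and Ta :: "nat \<Rightarrow> (real ^ 'd, 'b) ae_fun"
  assumes decomposition: "localizing_space_decomposition \<Omega> V N \<omega> Vl PV"
    and classes: "orthogonal_classes V N Vl J"
    and a: "bilinear_form V a" "symmetric_form V a" "coercive_form V a" "continuous_form V a"
    and f: "dual_functional V f"
    and u: "solves_on (pts V) a f u" "u \<noteq> 0"
    and training: "localized_training_configuration \<Omega> V N Vl u \<omega>s R S PS T"
    and T_split: "\<And>i \<phi>. i \<in> {1..N} \<Longrightarrow> \<phi> \<in> pts (S i) \<Longrightarrow> T i \<phi> = Tl i \<phi> + Ta i"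
    and Tl: "\<And>i. i \<in> {1..N} \<Longrightarrow> linear_map_on (pts (S i)) (Tl i)"
    and Ta: "\<And>i. i \<in> {1..N} \<Longrightarrow> Ta i \<in> Vl i"
    and Vt: "\<And>i. i \<in> {1..N} \<Longrightarrow> Vt i \<subseteq> Vl i"
            "\<And>i. i \<in> {1..N} \<Longrightarrow> closed_subspace V (Vt i)"
            "\<And>i. i \<in> {1..N} \<Longrightarrow> Ta i \<in> Vt i"
            "closed_subspace V (\<Sum>i=1..N. Vt i)"
    and ut: "solves_on (\<Sum>i=1..N. Vt i) a f ut"
  shows "hnorm V (u - ut) / hnorm V u
       \<le> sqrt (continuity_const V a / coercivity_const V a)
         * sqrt (real J * real (max_overlap \<Omega> N \<omega>s))
         * (MAX i\<in>{1..N}. opnorm (S i) V (\<lambda>s. Tl i s - orth_proj V (Vt i) (Tl i s))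
                            * opnorm (R i) (S i) (PS i))"
proof -
  interpret carrier_ip_space V
    using decomposition
    by unfold_locales (simp add: localizing_space_decomposition_def hilbert_space_def)
  have complete: mcomplete
    using decomposition by (simp add: localizing_space_decomposition_def hilbert_space_def)
  have sVl: "subspace (Vl i)" and VlV: "Vl i \<subseteq> pts V" if "i \<in> {1..N}" for i
    using decomposition that by (auto simp: localizing_space_decomposition_def)
  have sumVl: "(\<Sum>i=1..N. Vl i) = pts V"
    using decomposition by (simp add: localizing_space_decomposition_def)
  have R: "hilbert_space (R i) \<and> pts (R i) = restr (\<omega>s i) ` pts V"
    and S: "hilbert_space (S i)"
    and PS: "bounded_operator (R i) (S i) (PS i)"
    and T: "compact_operator (S i) (V\<lparr>pts := Vl i\<rparr>) (T i)"
    if "i \<in> {1..N}" for i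
    using training that unfolding localized_training_configuration_def by blast+
  have ptsR: "pts (R i) = restr (\<omega>s i) ` pts V"
    and R_ip: "carrier_ip_space (R i)" and S_ip: "carrier_ip_space (S i)"
    if "i \<in> {1..N}" for i
    using R[OF that] S[OF that] by (auto simp: hilbert_space_def carrier_ip_space_def)
  have overlap: "(\<Sum>i=1..N. (hnorm (R i) (restr (\<omega>s i) u))\<^sup>2)
      \<le> real (max_overlap \<Omega> N \<omega>s) * (hnorm V u)\<^sup>2"
    and u_sum: "u = (\<Sum>i=1..N. T i (PS i (restr (\<omega>s i) u)))"
    using training unfolding localized_training_configuration_def by blast+
  have uV: "u \<in> pts V"
    using u(1) by (simp add: solves_on_def)
  \<comment> \<open>Hence the maximum over the indices is taken over a nonempty set.\<close>
  have "N \<noteq> 0"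
  proof
    assume "N = 0"
    then have "u = 0" by (subst u_sum) simp
    then show False using u(2) by simp
  qed

  define s where "s i = PS i (restr (\<omega>s i) u)" for i
  define E where "E i = (\<lambda>\<phi>. Tl i \<phi> - orth_proj V (Vt i) (Tl i \<phi>))" for i
  define M where "M = (MAX i\<in>{1..N}. opnorm (S i) V (E i) * opnorm (R i) (S i) (PS i))"

  have r_in: "restr (\<omega>s i) u \<in> pts (R i)" if "i \<in> {1..N}" for i
    using ptsR[OF that] uV by simp
  have s_in: "s i \<in> pts (S i)" if "i \<in> {1..N}" for i
    using PS[OF that] r_in[OF that] by (auto simp: bounded_operator_def s_def)
  have Tl_in: "Tl i \<phi> \<in> Vl i" if i: "i \<in> {1..N}" and \<phi>: "\<phi> \<in> pts (S i)" for i \<phi>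
  proof -
    have "T i \<phi> \<in> Vl i"
      using T[OF i] \<phi> by (auto simp: compact_operator_def)
    then show ?thesis
      using subspace_diff[OF sVl[OF i] _ Ta[OF i], of "T i \<phi>"] T_split[OF i \<phi>] by simp
  qed
  have Tl_V: "Tl i \<phi> \<in> pts V" if "i \<in> {1..N}" "\<phi> \<in> pts (S i)" for i \<phi>
    using Tl_in[OF that] VlV[OF that(1)] by blast
  have P_in: "orth_proj V (Vt i) (Tl i \<phi>) \<in> Vt i" if "i \<in> {1..N}" "\<phi> \<in> pts (S i)" for i \<phi>
    using orth_proj_in[OF complete Vt(2) Tl_V] that by blast
  have E_in: "E i \<phi> \<in> Vl i" if i: "i \<in> {1..N}" and \<phi>: "\<phi> \<in> pts (S i)" for i \<phi>
    unfolding E_def using P_in[OF i \<phi>] Vt(1)[OF i]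
    by (intro subspace_diff[OF sVl[OF i] Tl_in[OF i \<phi>]]) blast
  have E_V: "E i \<phi> \<in> pts V" if "i \<in> {1..N}" "\<phi> \<in> pts (S i)" for i \<phi>
    using E_in[OF that] VlV[OF that(1)] by blast

  have local_bound: "hnorm V (E i (s i)) \<le> M * hnorm (R i) (restr (\<omega>s i) u)"
    and factor_nonneg: "0 \<le> opnorm (S i) V (E i) * opnorm (R i) (S i) (PS i)"
    if i: "i \<in> {1..N}" for i
  proof -
    \<comment> \<open>\<open>T i\<close> is compact as a map into \<open>Vl i\<close>, which carries the norm of \<open>V\<close>.\<close>
    obtain C where C: "hnorm V (Tl i \<phi>) \<le> C * hnorm (S i) \<phi>" if "\<phi> \<in> pts (S i)" for \<phi>
      using compact_operator_linear_part_bounded[OF S_ip[OF i]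
          subspace_ip_space[OF sVl[OF i] VlV[OF i]] T[OF i] Tl[OF i], of "Ta i"]
        Ta[OF i] T_split[OF i] by (auto simp: hnorm_def)
    have EC: "hnorm V (E i \<phi>) \<le> C * hnorm (S i) \<phi>" if "\<phi> \<in> pts (S i)" for \<phi>
      unfolding E_def
      using hnorm_minus_orth_proj_le[OF complete Vt(2)[OF i] Tl_V[OF i that]] C[OF that] by linarith
    obtain D where D: "hnorm (S i) (PS i x) \<le> D * hnorm (R i) x" if "x \<in> pts (R i)" for x
      using PS[OF i] unfolding bounded_operator_def by blast
    have PS_in: "PS i x \<in> pts (S i)" if "x \<in> pts (R i)" for x
      using PS[OF i] that by (auto simp: bounded_operator_def)
    have opE: "0 \<le> opnorm (S i) V (E i)"
      by (rule opnorm_nonneg[OF S_ip[OF i] carrier_ip_space_axioms E_V[OF i] EC])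
    have opPS: "0 \<le> opnorm (R i) (S i) (PS i)"
      by (rule opnorm_nonneg[OF R_ip[OF i] S_ip[OF i] PS_in D])
    show "0 \<le> opnorm (S i) V (E i) * opnorm (R i) (S i) (PS i)"
      using opE opPS by simp
    have "hnorm V (E i (s i)) \<le> opnorm (S i) V (E i) * hnorm (S i) (s i)"
      by (rule hnorm_le_opnorm[OF S_ip[OF i] carrier_ip_space_axioms E_V[OF i] EC s_in[OF i]])
    also have "hnorm (S i) (s i) \<le> opnorm (R i) (S i) (PS i) * hnorm (R i) (restr (\<omega>s i) u)"
      unfolding s_def by (rule hnorm_le_opnorm[OF R_ip[OF i] S_ip[OF i] PS_in D r_in[OF i]])
    finally have "hnorm V (E i (s i))
        \<le> (opnorm (S i) V (E i) * opnorm (R i) (S i) (PS i)) * hnorm (R i) (restr (\<omega>s i) u)"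
      using opE by (simp add: mult_left_mono mult.assoc)
    also have "\<dots> \<le> M * hnorm (R i) (restr (\<omega>s i) u)"
      unfolding M_def using i carrier_ip_space.hnorm_nonneg[OF R_ip[OF i] r_in[OF i]]
      by (intro mult_right_mono Max_ge) auto
    finally show "hnorm V (E i (s i)) \<le> M * hnorm (R i) (restr (\<omega>s i) u)" .
  qed
  have M_nonneg: "0 \<le> M"
  proof -
    have "1 \<in> {1..N}" using \<open>N \<noteq> 0\<close> by simp
    then show ?thesis
      unfolding M_def using factor_nonneg[of 1] by (intro order_trans[OF _ Max_ge]) auto
  qed

  define v where "v = (\<Sum>i=1..N. orth_proj V (Vt i) (Tl i (s i)) + Ta i)"
  have v: "v \<in> (\<Sum>i=1..N. Vt i)"
  proof -
    have "orth_proj V (Vt i) (Tl i (s i)) + Ta i \<in> Vt i" if i: "i \<in> {1..N}" for i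
      using Vt(2)[OF i] P_in[OF i s_in[OF i]] Vt(3)[OF i]
      by (auto simp: closed_subspace_def intro: subspace_add)
    then show ?thesis
      unfolding v_def by (subst set_sum_alt) auto
  qed
  have uv: "u - v = (\<Sum>i=1..N. E i (s i))"
  proof -
    have "u = (\<Sum>i=1..N. Tl i (s i) + Ta i)"
      by (subst u_sum) (simp add: s_def[symmetric] T_split s_in)
    then show ?thesis
      by (simp add: v_def E_def sum_subtractf[symmetric])
  qed

  have "(hnorm V (u - v))\<^sup>2 \<le> real J * (\<Sum>i=1..N. (hnorm V (E i (s i)))\<^sup>2)"
    unfolding uv
    by (rule hnorm_sum_orthogonal_classes_le[OF classes VlV]) (use E_in s_in in auto)
  also have "\<dots> \<le> real J * (\<Sum>i=1..N. (M * hnorm (R i) (restr (\<omega>s i) u))\<^sup>2)"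
    using E_V s_in by (intro mult_left_mono sum_mono power_mono local_bound hnorm_nonneg) auto
  also have "\<dots> = real J * M\<^sup>2 * (\<Sum>i=1..N. (hnorm (R i) (restr (\<omega>s i) u))\<^sup>2)"
    by (simp add: power_mult_distrib sum_distrib_left mult.assoc)
  also have "\<dots> \<le> real J * M\<^sup>2 * (real (max_overlap \<Omega> N \<omega>s) * (hnorm V u)\<^sup>2)"
    using overlap by (intro mult_left_mono) auto
  also have "\<dots> = real J * real (max_overlap \<Omega> N \<omega>s) * (M * hnorm V u)\<^sup>2"
    by (simp add: power_mult_distrib)
  finally have "hnorm V (u - v) \<le> sqrt (real J * real (max_overlap \<Omega> N \<omega>s) * (M * hnorm V u)\<^sup>2)"
    by (rule real_le_rsqrt)
  then have uv_le: "hnorm V (u - v) \<le> sqrt (real J * real (max_overlap \<Omega> N \<omega>s)) * M * hnorm V u"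
    using M_nonneg uV by (simp add: real_sqrt_mult)

  let ?q = "sqrt (continuity_const V a / coercivity_const V a)"
  have Vt_sub: "(\<Sum>i=1..N. Vt i) \<subseteq> pts V"
    unfolding sumVl[symmetric] using Vt(1) by (auto simp: set_sum_alt subset_iff)
  have "hnorm V (u - ut) \<le> ?q * hnorm V (u - v)"
    using Galerkin_quasi_optimal[OF a _ Vt_sub u(1) ut v] Vt(4)
    by (simp add: closed_subspace_def)
  also have "\<dots> \<le> ?q * (sqrt (real J * real (max_overlap \<Omega> N \<omega>s)) * M * hnorm V u)"
    using uv_le
  proof (rule mult_left_mono)
    have "0 \<le> continuity_const V a * hnorm V u * hnorm V u"
      using continuity_const_ge[OF a(4,1) uV uV] by linarith
    then have "0 \<le> continuity_const V a"
      using hnorm_pos[OF uV u(2)] by (simp add: zero_le_mult_iff)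
    then show "0 \<le> ?q"
      using a(3) by (simp add: coercive_form_def)
  qed
  finally have "hnorm V (u - ut) / hnorm V u
      \<le> ?q * sqrt (real J * real (max_overlap \<Omega> N \<omega>s)) * M"
    using hnorm_pos[OF uV u(2)] by (simp add: divide_le_eq mult.assoc)
  then show ?thesis
    unfolding M_def E_def .
qed

end
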